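(* Let $(\Omega,\mathcal F,\mathbb P)$ be a probability space, let $M_H,M_L\ge1$ be integers, and for $\varepsilon>0$ let $Q_H^\varepsilon,Q_N^\varepsilon,Q_E\in L^2(\Omega)$ be real-valued random variables ($Q_E$ independent of the parameter $\varepsilon$). Assume that $$Q_H^\varepsilon\longrightarrow Q_E\quad\text{in }L^2(\Omega)\text{ as }\varepsilon\to0,\qquad \mathrm{Var}(Q_E)>0.$$ Let $V_{N,E}^\varepsilon$ be the optimal variance with the two controls $(Q_N^\varepsilon,Q_E)$ and $V_E^\varepsilon$ the optimal variance with the control $Q_E$ alone (defined in the context). Then, as $\varepsilon\to0$, $$V_{N,E}^\varepsilon\longrightarrow\frac{\mathrm{Var}(Q_E)}{M_H+M_L},\qquad V_E^\varepsilon\longrightarrow\frac{\mathrm{Var}(Q_E)}{M_H+M_L}.$$ In particular, $V_E^\varepsilon-V_{N,E}^\varepsilon\to0$. Moreover, the optimal coefficient associated with the control $Q_E$ alone satisfies $$\lambda_E^{*,\varepsilon}=\frac{M_L}{M_H+M_L}\,\frac{\mathrm{Cov}(Q_H^\varepsilon,Q_E)}{\mathrm{Var}(Q_E)}\longrightarrow\frac{M_L}{M_H+M_L}.$$ If the expectation of the controls is known exactly (i.e. the Monte Carlo average of the controls over the second sample family in the estimators is replaced by their exact expectation; formally $M_L\to\infty$), then the limiting variance as $\varepsilon\to0$ is zero and $\lambda_E^{*,\varepsilon}\to1$.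
   Context: For a vector of controls $\mathbf Q\in L^2(\Omega;\mathbb R^m)$, a target $Q_H\in L^2(\Omega)$ and $\boldsymbol\lambda\in\mathbb R^m$, the control-variate estimator of $\mathbb E[Q_H]$ is $$\frac1{M_H}\sum_{k=1}^{M_H}\bigl(Q_H^{(k)}-\boldsymbol\lambda^T\mathbf Q^{(k)}\bigr)+\boldsymbol\lambda^T\frac1{M_L}\sum_{j=1}^{M_L}\widetilde{\mathbf Q}^{(j)},$$ where $\{(Q_H^{(k)},\mathbf Q^{(k)})\}_{k=1}^{M_H}$ are i.i.d. copies of $(Q_H,\mathbf Q)$ and $\{\widetilde{\mathbf Q}^{(j)}\}_{j=1}^{M_L}$ are i.i.d. copies of $\mathbf Q$, the second family being independent of the first. Denote by $\mathcal E_{N,E}^{\boldsymbol\lambda}[Q_H^\varepsilon]$ ($\boldsymbol\lambda\in\mathbb R^2$) this estimator with target $Q_H^\varepsilon$ and $\mathbf Q=(Q_N^\varepsilon,Q_E)^T$, and by $\mathcal E_E^\lambda[Q_H^\varepsilon]$ ($\lambda\in\mathbb R$) this estimator with target $Q_H^\varepsilon$ and the single control $Q_E$. Then $$V_{N,E}^\varepsilon:=\min_{\boldsymbol\lambda\in\mathbb R^2}\mathrm{Var}\bigl(\mathcal E_{N,E}^{\boldsymbol\lambda}[Q_H^\varepsilon]\bigr),\qquad V_E^\varepsilon:=\min_{\lambda\in\mathbb R}\mathrm{Var}\bigl(\mathcal E_E^\lambda[Q_H^\varepsilon]\bigr),$$ and $\lambda_E^{*,\varepsilon}$ is the minimizer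 in the definition of $V_E^\varepsilon$. When the expectation of the controls is known exactly, the corresponding estimator is $\frac1{M_H}\sum_{k=1}^{M_H}(Q_H^{(k)}-\boldsymbol\lambda^T\mathbf Q^{(k)})+\boldsymbol\lambda^T\mathbb E[\mathbf Q]$, and the optimal variances and $\lambda_E^{*,\varepsilon}$ are defined in the same way with this estimator. *)

theory Defs
  imports "HOL-Probability.Probability"
begin

text \<open>Membership in \<open>L\<^sup>2(\<Omega>; E)\<close> for a Euclidean space \<open>E\<close>, as a property of functions
  (representatives) rather than of equivalence classes, and the \<open>L\<^sup>2\<close> norm.\<close>

definition in_L2 :: "'a measure \<Rightarrow> ('a \<Rightarrow> 'e::euclidean_space) \<Rightarrow> bool" where
  "in_L2 M X \<longleftrightarrow> X \<in> borel_measurable M \<and> integrable M (\<lambda>\<omega>. (norm (X \<omega>))\<^sup>2)"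

definition L2_norm :: "'a measure \<Rightarrow> ('a \<Rightarrow> 'e::euclidean_space) \<Rightarrow> real" where
  "L2_norm M X = sqrt (\<integral>\<omega>. (norm (X \<omega>))\<^sup>2 \<partial>M)"

definition covariance :: "'a measure \<Rightarrow> ('a \<Rightarrow> real) \<Rightarrow> ('a \<Rightarrow> real) \<Rightarrow> real" where
  "covariance M X Y =
     (\<integral>\<omega>. (X \<omega> - prob_space.expectation M X) * (Y \<omega> - prob_space.expectation M Y) \<partial>M)"

text \<open>The \<open>Z i\<close> (\<open>i \<in> I\<close>), living on a probability space \<open>P\<close> that may differ from \<open>M\<close>, are
  i.i.d. copies of the random variable \<open>X\<close> on \<open>M\<close>.\<close>

definition iid_copies ::
  "'a measure \<Rightarrow> ('a \<Rightarrow> 'x::topological_space) \<Rightarrow> 'b measure \<Rightarrow> nat set \<Rightarrow> (nat \<Rightarrow> 'b \<Rightarrow> 'x) \<Rightarrow> bool"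
  where
  "iid_copies M X P I Z \<longleftrightarrow>
     prob_space.indep_vars P (\<lambda>_. borel) Z I \<and>
     (\<forall>i\<in>I. distr P borel (Z i) = distr M borel X)"

text \<open>The sigma-algebra on \<open>P\<close> generated by the family \<open>(Z i)\<close>, \<open>i \<in> I\<close>.  It is used to express
  independence of two families with different value types, which \<^const>\<open>prob_space.indep_var\<close>
  does not admit.\<close>

definition generated_events ::
  "'b measure \<Rightarrow> nat set \<Rightarrow> (nat \<Rightarrow> 'b \<Rightarrow> 'x::topological_space) \<Rightarrow> 'b set set" where
  "generated_events P I Z =
     sets (vimage_algebra (space P) (\<lambda>\<omega>. \<lambda>i\<in>I. Z i \<omega>) (Pi\<^sub>M I (\<lambda>_. borel)))"

text \<open>\<open>X k\<close> is the pair of the \<open>k\<close>-th copies of the target and of the controls, \<open>Y j\<close> is the \<open>j\<close>-th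
  copy of the controls in the second family.\<close>

definition cv_samples ::
  "'a measure \<Rightarrow> ('a \<Rightarrow> real) \<Rightarrow> ('a \<Rightarrow> 'e::euclidean_space) \<Rightarrow> nat \<Rightarrow> nat \<Rightarrow>
   'b measure \<Rightarrow> (nat \<Rightarrow> 'b \<Rightarrow> real \<times> 'e) \<Rightarrow> (nat \<Rightarrow> 'b \<Rightarrow> 'e) \<Rightarrow> bool" where
  "cv_samples M QH Q mH mL P X Y \<longleftrightarrow>
     prob_space P \<and>
     iid_copies M (\<lambda>\<omega>. (QH \<omega>, Q \<omega>)) P {1..mH} X \<and>
     iid_copies M Q P {1..mL} Y \<and>
     prob_space.indep_set P (generated_events P {1..mH} X) (generated_events P {1..mL} Y)"

text \<open>The space of coefficients is a Euclidean space \<open>'e\<close>, with \<open>\<lambda>\<^sup>T Q\<close> written as inner product: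
  \<open>real ^ 'm\<close> for a vector of controls, and \<open>real\<close> (where \<open>\<bullet>\<close> is multiplication) for a single one.\<close>

definition cv_estimator ::
  "nat \<Rightarrow> nat \<Rightarrow> (nat \<Rightarrow> 'b \<Rightarrow> real \<times> 'e::euclidean_space) \<Rightarrow> (nat \<Rightarrow> 'b \<Rightarrow> 'e) \<Rightarrow> 'e \<Rightarrow> 'b \<Rightarrow> real"
  where
  "cv_estimator mH mL X Y l \<omega> =
     (1 / real mH) * (\<Sum>k=1..mH. fst (X k \<omega>) - l \<bullet> snd (X k \<omega>)) +
     l \<bullet> ((1 / real mL) *\<^sub>R (\<Sum>j=1..mL. Y j \<omega>))"

text \<open>The estimator for known mean \<open>\<mu>\<close> of the controls.\<close>

definition cv_estimator_exact ::
  "nat \<Rightarrow> (nat \<Rightarrow> 'b \<Rightarrow> real \<times> 'e::euclidean_space) \<Rightarrow> 'e \<Rightarrow> 'e \<Rightarrow> 'b \<Rightarrow> real" where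
  "cv_estimator_exact mH X \<mu> l \<omega> =
     (1 / real mH) * (\<Sum>k=1..mH. fst (X k \<omega>) - l \<bullet> snd (X k \<omega>)) + l \<bullet> \<mu>"

text \<open>For a family \<open>E\<close> of estimators on \<open>P\<close> indexed by the coefficients.  The infimum stands
  for a minimum, and \<open>opt_coeff\<close> is meaningful, only if the minimum is attained (resp. attained
  at a single point), so a statement about them has to assert this as well.\<close>

definition is_opt_coeff :: "'b measure \<Rightarrow> ('e \<Rightarrow> 'b \<Rightarrow> real) \<Rightarrow> 'e \<Rightarrow> bool" where
  "is_opt_coeff P E = is_arg_min (\<lambda>l. prob_space.variance P (E l)) (\<lambda>_. True)"

definition opt_coeff :: "'b measure \<Rightarrow> ('e \<Rightarrow> 'b \<Rightarrow> real) \<Rightarrow> 'e" where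
  "opt_coeff P E = arg_min (\<lambda>l. prob_space.variance P (E l)) (\<lambda>_. True)"

definition opt_variance :: "'b measure \<Rightarrow> ('e \<Rightarrow> 'b \<Rightarrow> real) \<Rightarrow> real" where
  "opt_variance P E = (INF l. prob_space.variance P (E l))"

end

theory Submission
  imports Defs
begin

text \<open>By independence, the variance of an estimator with coefficient \<open>\<lambda>\<close> is
  \<open>a Var(Q\<^sub>H - \<lambda>\<^sup>T Q) + b Var(\<lambda>\<^sup>T Q)\<close>. With \<open>l\<^sub>0\<close> a solution of the normal equations, this equals
  its value at \<open>l\<^sub>0\<close> plus \<open>(a + b) Var((\<lambda> - l\<^sub>0)\<^sup>T Q)\<close>, which gives existence of minimizers, uniqueness for
  a single nonconstant control, and the formula for its optimal coefficient.
  Replacing \<open>\<lambda>\<^sup>T Q\<close> by an arbitrary square-integrable variable bounds the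
  optimal variance below by \<open>ab/(a + b) Var(Q\<^sub>H)\<close>, whatever the controls are. Using \<open>Q\<^sub>E\<close> alone with
  coefficient \<open>a/(a + b)\<close> gives an upper bound, and as \<open>Q\<^sub>H \<longrightarrow> Q\<^sub>E\<close> in \<open>L\<^sup>2\<close> both bounds converge to
  \<open>ab/(a + b) Var(Q\<^sub>E)\<close>.\<close>

section \<open>Square-integrable variables and covariance as a semidefinite bilinear form\<close>

context prob_space
begin

lemma in_L2_real_iff:
  fixes X :: "'a \<Rightarrow> real"
  shows "in_L2 M X \<longleftrightarrow> X \<in> borel_measurable M \<and> integrable M (\<lambda>\<omega>. (X \<omega>)\<^sup>2)"
  by (simp add: in_L2_def)

lemma in_L2_measurable: "in_L2 M X \<Longrightarrow> X \<in> borel_measurable M"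
  by (simp add: in_L2_def)

lemma in_L2_integrable:
  fixes X :: "'a \<Rightarrow> real"
  assumes "in_L2 M X"
  shows "integrable M X"
  using assms square_integrable_imp_integrable by (auto simp: in_L2_real_iff)

text \<open>Domination by \<open>X^2 + Y^2\<close>. This underlies both closure under sums and the
  expansion of covariances.\<close>

lemma in_L2_mult_integrable:
  fixes X Y :: "'a \<Rightarrow> real"
  assumes "in_L2 M X" "in_L2 M Y"
  shows "integrable M (\<lambda>\<omega>. X \<omega> * Y \<omega>)"
proof (rule Bochner_Integration.integrable_bound)
  show "integrable M (\<lambda>\<omega>. (X \<omega>)\<^sup>2 + (Y \<omega>)\<^sup>2)"
    using assms by (auto simp: in_L2_real_iff)
  show "(\<lambda>\<omega>. X \<omega> * Y \<omega>) \<in> borel_measurable M"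
    using assms by (auto simp: in_L2_real_iff)
  have "\<bar>x * y\<bar> \<le> \<bar>x\<^sup>2 + y\<^sup>2\<bar>" for x y :: real
  proof -
    have "2 * (\<bar>x\<bar> * \<bar>y\<bar>) \<le> x\<^sup>2 + y\<^sup>2"
      using sum_squares_bound[of "\<bar>x\<bar>" "\<bar>y\<bar>"] by simp
    moreover have "0 \<le> \<bar>x\<bar> * \<bar>y\<bar>"
      by simp
    ultimately show ?thesis
      unfolding abs_mult by linarith
  qed
  then show "AE \<omega> in M. norm (X \<omega> * Y \<omega>) \<le> norm ((X \<omega>)\<^sup>2 + (Y \<omega>)\<^sup>2)"
    by simp
qed

lemma in_L2_const: "in_L2 M (\<lambda>_. c)"
  by (simp add: in_L2_def)

lemma in_L2_add:
  fixes X Y :: "'a \<Rightarrow> real"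
  assumes "in_L2 M X" "in_L2 M Y"
  shows "in_L2 M (\<lambda>\<omega>. X \<omega> + Y \<omega>)"
  using assms in_L2_mult_integrable[OF assms]
  by (auto simp: in_L2_real_iff power2_sum mult.assoc)

lemma in_L2_cmult:
  fixes X :: "'a \<Rightarrow> real"
  assumes "in_L2 M X"
  shows "in_L2 M (\<lambda>\<omega>. c * X \<omega>)"
  using assms by (auto simp: in_L2_real_iff power_mult_distrib)

lemma in_L2_diff:
  fixes X Y :: "'a \<Rightarrow> real"
  assumes "in_L2 M X" "in_L2 M Y"
  shows "in_L2 M (\<lambda>\<omega>. X \<omega> - Y \<omega>)"
  using in_L2_add[OF assms(1) in_L2_cmult[OF assms(2), of "-1"]] by simp

lemma in_L2_sum:
  fixes X :: "'i \<Rightarrow> 'a \<Rightarrow> real"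
  assumes "\<And>i. i \<in> I \<Longrightarrow> in_L2 M (X i)"
  shows "in_L2 M (\<lambda>\<omega>. \<Sum>i\<in>I. X i \<omega>)"
  using assms by (induction I rule: infinite_finite_induct) (auto intro: in_L2_const in_L2_add)

text \<open>Cauchy-Schwarz gives the dominating function. A vector of controls is thereby reduced to
  scalar variables, and only real covariances have to be studied.\<close>

lemma in_L2_inner:
  fixes X :: "'a \<Rightarrow> 'e::euclidean_space"
  assumes "in_L2 M X"
  shows "in_L2 M (\<lambda>\<omega>. l \<bullet> X \<omega>)"
  unfolding in_L2_real_iff
proof
  show meas: "(\<lambda>\<omega>. l \<bullet> X \<omega>) \<in> borel_measurable M"
    using in_L2_measurable[OF assms] by measurable
  show "integrable M (\<lambda>\<omega>. (l \<bullet> X \<omega>)\<^sup>2)"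
  proof (rule Bochner_Integration.integrable_bound)
    show "integrable M (\<lambda>\<omega>. (norm l)\<^sup>2 * (norm (X \<omega>))\<^sup>2)"
      using assms by (simp add: in_L2_def)
    show "(\<lambda>\<omega>. (l \<bullet> X \<omega>)\<^sup>2) \<in> borel_measurable M"
      using meas by measurable
    have "\<bar>(l \<bullet> x)\<^sup>2\<bar> \<le> \<bar>(norm l)\<^sup>2 * (norm x)\<^sup>2\<bar>" for x
      using power_mono[OF Cauchy_Schwarz_ineq2[of l x], of 2] by (simp add: power_mult_distrib)
    then show "AE \<omega> in M. norm ((l \<bullet> X \<omega>)\<^sup>2) \<le> norm ((norm l)\<^sup>2 * (norm (X \<omega>))\<^sup>2)"
      by simp
  qed
qed

text \<open>Variances are treated as diagonal values of \<open>covariance\<close>, so that the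
  bilinear rules apply to them.\<close>

lemma variance_eq_covariance:
  fixes X :: "'a \<Rightarrow> real"
  shows "variance X = covariance M X X"
  by (simp add: covariance_def power2_eq_square)

lemma covariance_nonneg: "0 \<le> covariance M X X"
  using variance_positive[of X] by (simp only: variance_eq_covariance)

lemma covariance_commute: "covariance M X Y = covariance M Y X"
  by (simp add: covariance_def mult.commute)

lemma covariance_eq:
  assumes "in_L2 M X" "in_L2 M Y"
  shows "covariance M X Y = expectation (\<lambda>\<omega>. X \<omega> * Y \<omega>) - expectation X * expectation Y"
proof -
  note int = in_L2_integrable[OF assms(1)] in_L2_integrable[OF assms(2)]
    in_L2_mult_integrable[OF assms]
  have "covariance M X Y = expectation (\<lambda>\<omega>. X \<omega> * Y \<omega> - expectation Y * X \<omega>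
      - expectation X * Y \<omega> + expectation X * expectation Y)"
    by (simp add: covariance_def algebra_simps)
  also have "\<dots> = expectation (\<lambda>\<omega>. X \<omega> * Y \<omega>) - expectation X * expectation Y"
    using int by (simp add: prob_space)
  finally show ?thesis .
qed

lemma covariance_add_left:
  assumes "in_L2 M X" "in_L2 M Y" "in_L2 M Z"
  shows "covariance M (\<lambda>\<omega>. X \<omega> + Y \<omega>) Z = covariance M X Z + covariance M Y Z"
  using assms in_L2_mult_integrable[OF assms(1,3)] in_L2_mult_integrable[OF assms(2,3)]
  by (simp add: covariance_eq in_L2_add in_L2_integrable distrib_right)

lemma covariance_cmult_left:
  assumes "in_L2 M X" "in_L2 M Z"
  shows "covariance M (\<lambda>\<omega>. c * X \<omega>) Z = c * covariance M X Z"
  using assms by (simp add: covariance_eq in_L2_cmult mult.assoc right_diff_distrib)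

lemma covariance_diff_left:
  assumes "in_L2 M X" "in_L2 M Y" "in_L2 M Z"
  shows "covariance M (\<lambda>\<omega>. X \<omega> - Y \<omega>) Z = covariance M X Z - covariance M Y Z"
  using assms covariance_add_left[OF assms(1) in_L2_cmult[OF assms(2), of "-1"] assms(3)]
    covariance_cmult_left[OF assms(2,3), of "-1"]
  by simp

text \<open>Bilinearity and symmetry. Later instances with \<open>d = 0\<close> give scaling by a
  constant, those with \<open>c = 1\<close> and \<open>d = -1\<close> the variance of a
  difference.\<close>

lemma variance_linear_comb:
  assumes "in_L2 M X" "in_L2 M Y"
  shows "covariance M (\<lambda>\<omega>. c * X \<omega> + d * Y \<omega>) (\<lambda>\<omega>. c * X \<omega> + d * Y \<omega>)
    = c\<^sup>2 * covariance M X X + 2 * c * d * covariance M X Y + d\<^sup>2 * covariance M Y Y"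
proof -
  let ?Z = "\<lambda>\<omega>. c * X \<omega> + d * Y \<omega>"
  have Z: "in_L2 M ?Z"
    using assms by (intro in_L2_add in_L2_cmult)
  have *: "covariance M ?Z W = c * covariance M X W + d * covariance M Y W" if "in_L2 M W" for W
    using that assms by (simp add: covariance_add_left covariance_cmult_left in_L2_cmult)
  have "covariance M ?Z ?Z = c * covariance M ?Z X + d * covariance M ?Z Y"
    using *[OF Z] covariance_commute[of X ?Z] covariance_commute[of Y ?Z] by simp
  then show ?thesis
    using assms by (simp add: * covariance_commute[of Y X] power2_eq_square algebra_simps)
qed

text \<open>The variance of \<open>c X + d Y\<close> is a nonnegative quadratic form in
  \<open>c\<close> and \<open>d\<close>; suitable arguments force the inequality, a degenerate
  \<open>Y\<close> included.\<close>

lemma covariance_Cauchy_Schwarz: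
  assumes "in_L2 M X" "in_L2 M Y"
  shows "(covariance M X Y)\<^sup>2 \<le> covariance M X X * covariance M Y Y"
proof -
  let ?x = "covariance M X X" and ?y = "covariance M Y Y" and ?c = "covariance M X Y"
  have nonneg: "0 \<le> c\<^sup>2 * ?x + 2 * c * d * ?c + d\<^sup>2 * ?y" for c d
    using covariance_nonneg[of "\<lambda>\<omega>. c * X \<omega> + d * Y \<omega>"] by (simp only: variance_linear_comb[OF assms])
  show ?thesis
  proof (cases "?y = 0")
    case True
    have "?c = 0"
    proof (rule ccontr)
      \<comment> \<open>With \<open>?y = 0\<close> the form is affine in \<open>d\<close>; the
        chosen \<open>d\<close> makes it equal to -1 at \<open>c = 1\<close>.\<close>
      assume "?c \<noteq> 0"
      then show False
        using nonneg[of 1 "- (?x + 1) / (2 * ?c)"] True by (simp add: field_simps)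
    qed
    then show ?thesis
      using True by simp
  next
    case False
    then have y: "?y > 0"
      using covariance_nonneg[of Y] by linarith
    \<comment> \<open>At \<open>c = ?y\<close>, \<open>d = - ?c\<close> the form has the factor
      \<open>?y\<close>, which can then be cancelled.\<close>
    have "0 \<le> ?y * (?x * ?y - ?c\<^sup>2)"
      using nonneg[of ?y "- ?c"] by (simp add: power2_eq_square algebra_simps)
    then show ?thesis
      using y by (simp add: zero_le_mult_iff)
  qed
qed

section \<open>Independence, and transfer between probability spaces\<close>

lemma indep_var_covariance:
  assumes "indep_var borel X borel Y" "in_L2 M X" "in_L2 M Y"
  shows "covariance M X Y = 0"
  using assms by (simp add: covariance_eq indep_var_lebesgue_integral in_L2_integrable)

lemma indep_var_variance_add:
  assumes "indep_var borel X borel Y" "in_L2 M X" "in_L2 M Y"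
  shows "covariance M (\<lambda>\<omega>. X \<omega> + Y \<omega>) (\<lambda>\<omega>. X \<omega> + Y \<omega>) = covariance M X X + covariance M Y Y"
  using variance_linear_comb[OF assms(2,3), of 1 1] indep_var_covariance[OF assms] by simp

text \<open>Bienayme's identity: in the induction the new variable is independent of the sum of the
  others, so there is no cross term.\<close>

lemma indep_vars_variance_sum:
  fixes X :: "'i \<Rightarrow> 'a \<Rightarrow> real"
  assumes "finite I" "indep_vars (\<lambda>_. borel) X I" "\<And>i. i \<in> I \<Longrightarrow> in_L2 M (X i)"
  shows "covariance M (\<lambda>\<omega>. \<Sum>i\<in>I. X i \<omega>) (\<lambda>\<omega>. \<Sum>i\<in>I. X i \<omega>) = (\<Sum>i\<in>I. covariance M (X i) (X i))"
  using assms
proof (induction I)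
  case empty
  then show ?case
    by (simp add: covariance_def)
next
  case (insert i I)
  have "indep_var borel (X i) borel (\<lambda>\<omega>. \<Sum>i\<in>I. X i \<omega>)"
    using insert by (intro indep_vars_sum) auto
  moreover have "indep_vars (\<lambda>_. borel) X I"
    using insert.prems(1) by (rule indep_vars_subset) auto
  ultimately show ?case
    using insert by (simp add: indep_var_variance_add in_L2_sum)
qed

lemma variance_iid_mean:
  fixes U :: "nat \<Rightarrow> 'a \<Rightarrow> real"
  assumes "indep_vars (\<lambda>_. borel) U {1..n}" "n \<ge> 1"
    and "\<And>i. i \<in> {1..n} \<Longrightarrow> in_L2 M (U i)" "\<And>i. i \<in> {1..n} \<Longrightarrow> covariance M (U i) (U i) = v"
  shows "covariance M (\<lambda>\<omega>. 1 / real n * (\<Sum>i=1..n. U i \<omega>)) (\<lambda>\<omega>. 1 / real n * (\<Sum>i=1..n. U i \<omega>))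
    = v / real n"
proof -
  have L2: "in_L2 M (\<lambda>\<omega>. \<Sum>i=1..n. U i \<omega>)"
    using assms(3) by (rule in_L2_sum)
  show ?thesis
    using variance_linear_comb[OF L2 L2, of "1 / real n" 0]
      indep_vars_variance_sum[OF _ assms(1,3)] assms(2,4)
    by (simp add: power2_eq_square)
qed

lemma variance_add_const:
  fixes X :: "'a \<Rightarrow> real"
  assumes "in_L2 M X"
  shows "covariance M (\<lambda>\<omega>. X \<omega> + c) (\<lambda>\<omega>. X \<omega> + c) = covariance M X X"
  using in_L2_integrable[OF assms] by (simp add: covariance_def prob_space)

text \<open>Both sides are integrals against the common law. This carries facts from the original
  space to the samples, which live on another space and are linked to it by their laws.\<close>

lemma in_L2_distr:
  assumes "distr M borel Z = distr N borel W" "Z \<in> borel_measurable M" "W \<in> borel_measurable N"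
    and "g \<in> borel_measurable borel"
  shows "in_L2 M (\<lambda>\<omega>. g (Z \<omega>)) \<longleftrightarrow> in_L2 N (\<lambda>\<omega>. g (W \<omega>))"
proof -
  have "integrable M (\<lambda>\<omega>. (norm (g (Z \<omega>)))\<^sup>2) \<longleftrightarrow> integrable (distr M borel Z) (\<lambda>x. (norm (g x))\<^sup>2)"
    using assms by (subst integrable_distr_eq) auto
  also have "\<dots> \<longleftrightarrow> integrable N (\<lambda>\<omega>. (norm (g (W \<omega>)))\<^sup>2)"
    unfolding assms(1) using assms by (subst integrable_distr_eq) auto
  finally show ?thesis
    using assms by (simp add: in_L2_def)
qed

lemma covariance_distr:
  assumes "distr M borel Z = distr N borel W" "Z \<in> borel_measurable M" "W \<in> borel_measurable N"
    and "g \<in> borel_measurable borel" "h \<in> borel_measurable borel"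
  shows "covariance M (\<lambda>\<omega>. g (Z \<omega>)) (\<lambda>\<omega>. h (Z \<omega>)) = covariance N (\<lambda>\<omega>. g (W \<omega>)) (\<lambda>\<omega>. h (W \<omega>))"
proof -
  have *: "(\<integral>\<omega>. f (Z \<omega>) \<partial>M) = (\<integral>\<omega>. f (W \<omega>) \<partial>N)"
    if "f \<in> borel_measurable borel" for f :: "_ \<Rightarrow> real"
    using that assms integral_distr[of Z M borel f] integral_distr[of W N borel f] by simp
  show ?thesis
    using assms *[of g] *[of h]
      *[of "\<lambda>x. (g x - (\<integral>\<omega>. g (W \<omega>) \<partial>N)) * (h x - (\<integral>\<omega>. h (W \<omega>) \<partial>N))"]
    by (simp add: covariance_def)
qed

end

section \<open>Normal equations and the quadratic cost\<close>

text \<open>In finite dimension the range of a self-adjoint map is the orthogonal complement of its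
  kernel. The component \<open>z\<close> of \<open>g\<close> orthogonal to the range lies in the
  kernel, hence is orthogonal to \<open>g\<close> and so to itself.\<close>

lemma selfadjoint_solvable:
  fixes K :: "'e::euclidean_space \<Rightarrow> 'e"
  assumes "linear K" "\<And>x y. K x \<bullet> y = x \<bullet> K y" "\<And>v. K v = 0 \<Longrightarrow> g \<bullet> v = 0"
  obtains l where "K l = g"
proof -
  have span: "span (range K) = range K"
    using assms(1) by (simp add: linear_subspace_image span_eq_iff)
  obtain y z where y: "y \<in> span (range K)"
    and z: "\<And>w. w \<in> span (range K) \<Longrightarrow> orthogonal z w" and g: "g = y + z"
    using orthogonal_subspace_decomp_exists[of "range K" g] by metis
  have "K z \<bullet> w = 0" for w
    using z[of "K w"] by (simp add: span assms(2) orthogonal_def)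
  then have "K z = 0"
    using inner_eq_zero_iff by blast
  then have "g \<bullet> z = 0"
    by (rule assms(3))
  moreover have "y \<bullet> z = 0"
    using z[OF y] by (simp add: orthogonal_def inner_commute)
  ultimately have "z = 0"
    by (simp add: g inner_add_left)
  then show thesis
    using y g that by (auto simp: span)
qed

text \<open>The variance of the estimators, with \<open>a = 1/M\<^sub>H\<close>, and \<open>b = 1/M\<^sub>L\<close> in the sampled case,
  \<open>b = 0\<close> for exactly known control means.\<close>

definition cv_cost ::
  "'a measure \<Rightarrow> real \<Rightarrow> real \<Rightarrow> ('a \<Rightarrow> real) \<Rightarrow> ('a \<Rightarrow> 'e::euclidean_space) \<Rightarrow> 'e \<Rightarrow> real" where
  "cv_cost M a b U Q l = a * covariance M (\<lambda>\<omega>. U \<omega> - l \<bullet> Q \<omega>) (\<lambda>\<omega>. U \<omega> - l \<bullet> Q \<omega>)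
    + b * covariance M (\<lambda>\<omega>. l \<bullet> Q \<omega>) (\<lambda>\<omega>. l \<bullet> Q \<omega>)"

context prob_space
begin

lemma variance_diff:
  assumes "in_L2 M X" "in_L2 M Y"
  shows "covariance M (\<lambda>\<omega>. X \<omega> - Y \<omega>) (\<lambda>\<omega>. X \<omega> - Y \<omega>)
    = covariance M X X - 2 * covariance M X Y + covariance M Y Y"
  using variance_linear_comb[OF assms, of 1 "-1"] by simp

lemma covariance_inner_left:
  fixes Q :: "'a \<Rightarrow> 'e::euclidean_space"
  assumes "in_L2 M Q" "in_L2 M Z"
  shows "linear (\<lambda>l. covariance M (\<lambda>\<omega>. l \<bullet> Q \<omega>) Z)"
proof (rule linearI)
  fix x y :: 'e and c :: real
  show "covariance M (\<lambda>\<omega>. (x + y) \<bullet> Q \<omega>) Z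
      = covariance M (\<lambda>\<omega>. x \<bullet> Q \<omega>) Z + covariance M (\<lambda>\<omega>. y \<bullet> Q \<omega>) Z"
    using assms by (simp add: inner_add_left covariance_add_left in_L2_inner)
  show "covariance M (\<lambda>\<omega>. (c *\<^sub>R x) \<bullet> Q \<omega>) Z = c *\<^sub>R covariance M (\<lambda>\<omega>. x \<bullet> Q \<omega>) Z"
    using assms by (simp add: covariance_cmult_left in_L2_inner)
qed

text \<open>The covariance matrix of the controls may be singular; Cauchy--Schwarz shows that the right-hand
  side vanishes on its kernel.\<close>

lemma normal_equations_solvable:
  fixes Q :: "'a \<Rightarrow> 'e::euclidean_space"
  assumes "in_L2 M U" "in_L2 M Q"
  obtains l where
    "\<And>v. covariance M (\<lambda>\<omega>. l \<bullet> Q \<omega>) (\<lambda>\<omega>. v \<bullet> Q \<omega>) = covariance M U (\<lambda>\<omega>. v \<bullet> Q \<omega>)"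
proof -
  let ?c = "\<lambda>l v. covariance M (\<lambda>\<omega>. l \<bullet> Q \<omega>) (\<lambda>\<omega>. v \<bullet> Q \<omega>)"
  \<comment> \<open>The adjoint of a linear functional, evaluated at 1, is its Riesz vector. So
    \<open>K\<close> is the covariance operator of \<open>Q\<close> and \<open>g\<close> the vector
    of covariances with \<open>U\<close>, without coordinates.\<close>
  define K where "K l = adjoint (\<lambda>v. ?c v l) 1" for l
  define g where "g = adjoint (\<lambda>v. covariance M (\<lambda>\<omega>. v \<bullet> Q \<omega>) U) 1"
  have K: "v \<bullet> K l = ?c v l" for v l
    unfolding K_def
    by (subst adjoint_works) (auto intro: covariance_inner_left in_L2_inner assms)
  have g: "v \<bullet> g = covariance M (\<lambda>\<omega>. v \<bullet> Q \<omega>) U" for v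
    unfolding g_def
    by (subst adjoint_works) (auto intro: covariance_inner_left assms)
  have lin: "linear (\<lambda>l. ?c l v)" for v
    by (intro covariance_inner_left in_L2_inner assms)
  have "linear K"
  proof (rule linearI)
    fix x y :: 'e and c :: real
    have "v \<bullet> K (x + y) = v \<bullet> (K x + K y)" for v
      using linear_add[OF lin, of x y v] covariance_commute by (simp only: K inner_add_right)
    then show "K (x + y) = K x + K y"
      using vector_eq_ldot by blast
    have "v \<bullet> K (c *\<^sub>R x) = v \<bullet> (c *\<^sub>R K x)" for v
      using linear_cmul[OF lin, of c x v] covariance_commute
      by (simp only: K inner_scaleR_right real_scaleR_def)
    then show "K (c *\<^sub>R x) = c *\<^sub>R K x"
      using vector_eq_ldot by blast
  qed
  moreover have "K x \<bullet> y = x \<bullet> K y" for x y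
    using K[of x y] K[of y x] covariance_commute[of "\<lambda>\<omega>. x \<bullet> Q \<omega>" "\<lambda>\<omega>. y \<bullet> Q \<omega>"]
    by (simp add: inner_commute)
  moreover have "g \<bullet> v = 0" if "K v = 0" for v
  proof -
    have "?c v v = 0"
      using K[of v v] that by simp
    then have "(covariance M (\<lambda>\<omega>. v \<bullet> Q \<omega>) U)\<^sup>2 \<le> 0"
      using covariance_Cauchy_Schwarz[OF in_L2_inner[OF assms(2), of v] assms(1)] by simp
    then show ?thesis
      using g[of v] by (simp add: inner_commute)
  qed
  ultimately obtain l where "K l = g"
    by (rule selfadjoint_solvable)
  show thesis
  proof (rule that)
    show "?c l v = covariance M U (\<lambda>\<omega>. v \<bullet> Q \<omega>)" for v
      using K[of v l] g[of v] by (simp only: \<open>K l = g\<close> covariance_commute)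
  qed
qed

text \<open>Completing the square. The third assumption says that the derivative of the quadratic
  cost vanishes at \<open>l0\<close> in every direction \<open>v\<close>, so no linear term is
  left.\<close>

lemma cv_cost_eq:
  fixes Q :: "'a \<Rightarrow> 'e::euclidean_space"
  assumes "in_L2 M U" "in_L2 M Q"
    and "\<And>v. (a + b) * covariance M (\<lambda>\<omega>. l0 \<bullet> Q \<omega>) (\<lambda>\<omega>. v \<bullet> Q \<omega>)
      = a * covariance M U (\<lambda>\<omega>. v \<bullet> Q \<omega>)"
  shows "cv_cost M a b U Q l = cv_cost M a b U Q l0
    + (a + b) * covariance M (\<lambda>\<omega>. (l - l0) \<bullet> Q \<omega>) (\<lambda>\<omega>. (l - l0) \<bullet> Q \<omega>)"
proof -
  let ?c = "\<lambda>l v. covariance M (\<lambda>\<omega>. l \<bullet> Q \<omega>) (\<lambda>\<omega>. v \<bullet> Q \<omega>)"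
  let ?d = "\<lambda>v. covariance M U (\<lambda>\<omega>. v \<bullet> Q \<omega>)"
  note L2 = in_L2_inner[OF assms(2)]
  have cost: "cv_cost M a b U Q l = a * covariance M U U - 2 * (a * ?d l) + (a + b) * ?c l l" for l
    by (simp add: cv_cost_def variance_diff L2 assms algebra_simps)
  have "?c (l - l0) (l - l0) = ?c l l - 2 * ?c l0 l + ?c l0 l0"
    by (simp add: inner_diff_left variance_diff L2 covariance_commute[of "\<lambda>\<omega>. l \<bullet> Q \<omega>" "\<lambda>\<omega>. l0 \<bullet> Q \<omega>"])
  \<comment> \<open>The normal equations in the directions \<open>l\<close> and \<open>l0\<close>
    eliminate the covariances with \<open>U\<close>.\<close>
  moreover have "cv_cost M a b U Q l - cv_cost M a b U Q l0
      = (a + b) * (?c l l - 2 * ?c l0 l + ?c l0 l0)"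
    unfolding cost using assms(3)[of l] assms(3)[of l0] by (simp add: algebra_simps)
  ultimately show ?thesis
    by simp
qed

text \<open>Existence only: if a nontrivial combination of the controls has variance 0, the
  minimizers form a whole affine subspace.\<close>

lemma cv_cost_minimizer:
  fixes Q :: "'a \<Rightarrow> 'e::euclidean_space"
  assumes "in_L2 M U" "in_L2 M Q" "a + b > 0"
  shows "\<exists>l0. \<forall>l. cv_cost M a b U Q l0 \<le> cv_cost M a b U Q l"
proof -
  obtain l1 where l1: "\<And>v. covariance M (\<lambda>\<omega>. l1 \<bullet> Q \<omega>) (\<lambda>\<omega>. v \<bullet> Q \<omega>) = covariance M U (\<lambda>\<omega>. v \<bullet> Q \<omega>)"
    using normal_equations_solvable[OF assms(1,2)] by blast
  \<comment> \<open>The normal equations of the cost have weight \<open>a + b\<close> on the left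
    and \<open>a\<close> on the right, so the solution for equal weights is rescaled by
    \<open>?t\<close>.\<close>
  let ?t = "a / (a + b)"
  have t: "(a + b) * ?t = a"
    using assms(3) by simp
  have "(a + b) * covariance M (\<lambda>\<omega>. (?t *\<^sub>R l1) \<bullet> Q \<omega>) (\<lambda>\<omega>. v \<bullet> Q \<omega>)
      = a * covariance M U (\<lambda>\<omega>. v \<bullet> Q \<omega>)" for v
    unfolding inner_scaleR_left
      covariance_cmult_left[OF in_L2_inner[OF assms(2)] in_L2_inner[OF assms(2)]] l1
      mult.assoc[symmetric] t ..
  note cost = cv_cost_eq[OF assms(1,2) this]
  have "cv_cost M a b U Q (?t *\<^sub>R l1) \<le> cv_cost M a b U Q l" for l
    unfolding cost[of l] using mult_nonneg_nonneg[OF less_imp_le[OF assms(3)] covariance_nonneg]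
    by (rule add_increasing2) simp
  then show ?thesis
    by blast
qed

text \<open>The gap is exactly \<open>a + b\<close> times the variance of
  \<open>t U - l \<bullet> Q\<close> with \<open>t = a / (a + b)\<close>, so the ideal combination
  of controls would be \<open>t U\<close>.\<close>

lemma cv_cost_lower_bound:
  fixes Q :: "'a \<Rightarrow> 'e::euclidean_space"
  assumes "in_L2 M U" "in_L2 M Q" "a + b > 0"
  shows "a * b / (a + b) * covariance M U U \<le> cv_cost M a b U Q l"
proof -
  \<comment> \<open>Expressing \<open>a\<close> and \<open>b\<close> through \<open>s\<close> and
    \<open>t\<close> turns a rational identity into a polynomial one.\<close>
  define s t where "s = a + b" and "t = a / s"
  have s: "s > 0" and a: "a = t * s" and b: "b = s - t * s"
    using assms(3) by (auto simp: s_def t_def)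
  let ?W = "\<lambda>\<omega>. l \<bullet> Q \<omega>"
  let ?Z = "\<lambda>\<omega>. t * U \<omega> + (-1) * ?W \<omega>"
  have W: "in_L2 M ?W"
    using assms(2) by (rule in_L2_inner)
  have eq: "a * b / (a + b) = t * (s - t * s)"
    using s by (simp add: a b)
  have "cv_cost M a b U Q l - a * b / (a + b) * covariance M U U = s * covariance M ?Z ?Z"
    unfolding eq cv_cost_def variance_linear_comb[OF assms(1) W] variance_diff[OF assms(1) W]
    by (simp add: a b power2_eq_square algebra_simps)
  moreover have "0 \<le> s * covariance M ?Z ?Z"
    using s covariance_nonneg[of ?Z] by simp
  ultimately show ?thesis
    by linarith
qed

end

section \<open>Variance of the estimators\<close>

text \<open>The sigma-algebra of a measurable function of a family is contained in that of the
  family, so independence is inherited.\<close>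

lemma (in prob_space) indep_var_generated_events:
  assumes "indep_set (generated_events M I X) (generated_events M J Y)"
    and f: "f \<in> Pi\<^sub>M I (\<lambda>_. borel) \<rightarrow>\<^sub>M borel" and g: "g \<in> Pi\<^sub>M J (\<lambda>_. borel) \<rightarrow>\<^sub>M borel"
  shows "indep_var borel (\<lambda>\<omega>. f (\<lambda>i\<in>I. X i \<omega>)) borel (\<lambda>\<omega>. g (\<lambda>j\<in>J. Y j \<omega>))"
proof -
  have gen: "sigma_sets (space M) {(\<lambda>\<omega>. h (\<lambda>i\<in>K. Z i \<omega>)) -` A \<inter> space M | A. A \<in> sets borel}
      \<subseteq> generated_events M K Z" if h: "h \<in> Pi\<^sub>M K (\<lambda>_. borel) \<rightarrow>\<^sub>M borel"
    for h :: "(nat \<Rightarrow> 'x::topological_space) \<Rightarrow> 'y::topological_space" and K and Z :: "nat \<Rightarrow> 'a \<Rightarrow> 'x"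
  proof -
    let ?N = "vimage_algebra (space M) (\<lambda>\<omega>. \<lambda>i\<in>K. Z i \<omega>) (Pi\<^sub>M K (\<lambda>_. borel))"
    \<comment> \<open>Restriction makes the tuple extensional, so it takes values in the product
      space, as the initial sigma-algebra requires.\<close>
    have "(\<lambda>\<omega>. \<lambda>i\<in>K. Z i \<omega>) \<in> ?N \<rightarrow>\<^sub>M Pi\<^sub>M K (\<lambda>_. borel)"
      by (rule measurable_vimage_algebra1) (auto simp: space_PiM)
    from measurable_compose[OF this h]
    have "(\<lambda>\<omega>. h (\<lambda>i\<in>K. Z i \<omega>)) -` A \<inter> space ?N \<in> sets ?N" if "A \<in> sets borel" for A
      using that by (rule measurable_sets)
    then have "{(\<lambda>\<omega>. h (\<lambda>i\<in>K. Z i \<omega>)) -` A \<inter> space M | A. A \<in> sets borel} \<subseteq> sets ?N"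
      by auto
    from sets.sigma_sets_subset[OF this] show ?thesis
      by (simp add: generated_events_def)
  qed
  have ev: "generated_events M I X \<subseteq> events" "generated_events M J Y \<subseteq> events"
    and indep: "\<And>A B. A \<in> generated_events M I X \<Longrightarrow> B \<in> generated_events M J Y \<Longrightarrow>
      prob (A \<inter> B) = prob A * prob B"
    using assms(1) unfolding indep_sets2_eq by auto
  \<comment> \<open>\<open>indep_var\<close> includes measurability; it is recovered from the
    generated sigma-algebras consisting of events.\<close>
  have meas: "Z \<in> M \<rightarrow>\<^sub>M borel"
    if sub: "sigma_sets (space M) {Z -` A \<inter> space M | A. A \<in> sets borel} \<subseteq> events"
    for Z :: "'a \<Rightarrow> 'z::topological_space"
  proof (rule measurableI)
    show "Z -` A \<inter> space M \<in> events" if "A \<in> sets borel" for A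
      using that sub by (blast intro: sigma_sets.Basic)
  qed simp
  show ?thesis
    unfolding indep_var_eq indep_sets2_eq
    using gen[OF f, of X] gen[OF g, of Y] ev
    by (intro conjI meas ballI indep) (auto dest: subsetD)
qed

text \<open>The sampled estimator is a sum of two independent sample means, of
  \<open>U - l \<bullet> Q\<close> and of \<open>l \<bullet> Q\<close>, whose variances are divided
  by \<open>mH\<close> and \<open>mL\<close>. In the exact estimator the second mean becomes a
  constant shift, hence weight 0 for any \<open>\<mu>\<close>.\<close>

lemma cv_estimator_variance:
  fixes Q :: "'a \<Rightarrow> 'e::euclidean_space"
  assumes "prob_space M" "mH \<ge> 1" "mL \<ge> 1" "in_L2 M U" "in_L2 M Q"
    and "cv_samples M U Q mH mL P X Y"
  shows "prob_space.variance P (cv_estimator mH mL X Y l)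
      = cv_cost M (1 / real mH) (1 / real mL) U Q l" (is ?sampled)
    and "prob_space.variance P (cv_estimator_exact mH X \<mu> l)
      = cv_cost M (1 / real mH) 0 U Q l" (is ?exact)
proof -
  interpret M: prob_space M by fact
  interpret P: prob_space P
    using assms(6) by (simp add: cv_samples_def)
  \<comment> \<open>\<open>h\<close> makes each summand a measurable function of one sample, so that
    laws and independence carry over.\<close>
  define h where "h x = fst x - l \<bullet> snd x" for x :: "real \<times> 'e"
  have h: "h \<in> borel_measurable borel"
    unfolding h_def by (intro borel_measurable_continuous_onI continuous_intros)
  have inner: "(\<bullet>) l \<in> borel_measurable borel"
    by (intro borel_measurable_continuous_onI continuous_intros)
  have samples: "P.indep_vars (\<lambda>_. borel) X {1..mH}" "P.indep_vars (\<lambda>_. borel) Y {1..mL}"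
    "P.indep_set (generated_events P {1..mH} X) (generated_events P {1..mL} Y)"
    and X: "\<And>k. k \<in> {1..mH} \<Longrightarrow> distr P borel (X k) = distr M borel (\<lambda>\<omega>. (U \<omega>, Q \<omega>))"
    and Y: "\<And>j. j \<in> {1..mL} \<Longrightarrow> distr P borel (Y j) = distr M borel Q"
    using assms(6) by (auto simp: cv_samples_def iid_copies_def)
  have meas: "\<And>k. k \<in> {1..mH} \<Longrightarrow> X k \<in> borel_measurable P"
    "\<And>j. j \<in> {1..mL} \<Longrightarrow> Y j \<in> borel_measurable P"
    using samples by (auto simp: P.indep_vars_def)
  have U: "U \<in> borel_measurable M" and Q: "Q \<in> borel_measurable M"
    using assms(4,5) by (auto simp: in_L2_def)
  then have UQ: "(\<lambda>\<omega>. (U \<omega>, Q \<omega>)) \<in> borel_measurable M"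
    by measurable
  have L2h: "in_L2 M (\<lambda>\<omega>. h (U \<omega>, Q \<omega>))"
    using assms by (simp add: h_def M.in_L2_diff M.in_L2_inner)
  have L2: "\<And>k. k \<in> {1..mH} \<Longrightarrow> in_L2 P (\<lambda>\<omega>. h (X k \<omega>))"
    "\<And>j. j \<in> {1..mL} \<Longrightarrow> in_L2 P (\<lambda>\<omega>. l \<bullet> Y j \<omega>)"
    using P.in_L2_distr[OF X meas(1) UQ h] L2h P.in_L2_distr[OF Y meas(2) Q inner]
      M.in_L2_inner[OF assms(5), of l] by auto
  let ?A = "\<lambda>\<omega>. 1 / real mH * (\<Sum>k=1..mH. h (X k \<omega>))"
  let ?B = "\<lambda>\<omega>. 1 / real mL * (\<Sum>j=1..mL. l \<bullet> Y j \<omega>)"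
  have L2A: "in_L2 P ?A" and L2B: "in_L2 P ?B"
    by (intro P.in_L2_cmult P.in_L2_sum L2; assumption)+
  have varA: "covariance P ?A ?A = covariance M (\<lambda>\<omega>. h (U \<omega>, Q \<omega>)) (\<lambda>\<omega>. h (U \<omega>, Q \<omega>)) / real mH"
    using P.indep_vars_compose2[OF samples(1), of "\<lambda>_. h" "\<lambda>_. borel"] h L2(1) assms(2)
      P.covariance_distr[OF X meas(1) UQ h h]
    by (intro P.variance_iid_mean) auto
  have varB: "covariance P ?B ?B = covariance M (\<lambda>\<omega>. l \<bullet> Q \<omega>) (\<lambda>\<omega>. l \<bullet> Q \<omega>) / real mL"
    using P.indep_vars_compose2[OF samples(2), of "\<lambda>_. (\<bullet>) l" "\<lambda>_. borel"] inner L2(2) assms(3)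
      P.covariance_distr[OF Y meas(2) Q inner inner]
    by (intro P.variance_iid_mean) auto
  \<comment> \<open>The abstractions exhibit both averages as functions of restricted tuples;
    simplification then removes the restrictions, since the summation indices lie in the index
    sets.\<close>
  have "P.indep_var borel (\<lambda>\<omega>. (\<lambda>x. 1 / real mH * (\<Sum>k=1..mH. h (x k))) (\<lambda>k\<in>{1..mH}. X k \<omega>))
      borel (\<lambda>\<omega>. (\<lambda>y. 1 / real mL * (\<Sum>j=1..mL. l \<bullet> y j)) (\<lambda>j\<in>{1..mL}. Y j \<omega>))"
    using h inner
    by (intro P.indep_var_generated_events samples borel_measurable_times borel_measurable_const
        borel_measurable_sum measurable_compose[OF measurable_component_singleton]) auto
  then have "P.indep_var borel ?A borel ?B"
    by simp
  from P.indep_var_variance_add[OF this L2A L2B]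
  have "covariance P (\<lambda>\<omega>. ?A \<omega> + ?B \<omega>) (\<lambda>\<omega>. ?A \<omega> + ?B \<omega>)
      = cv_cost M (1 / real mH) (1 / real mL) U Q l"
    unfolding varA varB by (simp add: cv_cost_def h_def)
  moreover have "cv_estimator mH mL X Y l = (\<lambda>\<omega>. ?A \<omega> + ?B \<omega>)"
    by (simp add: fun_eq_iff cv_estimator_def h_def inner_sum_right)
  ultimately show ?sampled
    unfolding P.variance_eq_covariance by simp
  have "covariance P (\<lambda>\<omega>. ?A \<omega> + l \<bullet> \<mu>) (\<lambda>\<omega>. ?A \<omega> + l \<bullet> \<mu>) = cv_cost M (1 / real mH) 0 U Q l"
    unfolding P.variance_add_const[OF L2A] varA by (simp add: cv_cost_def h_def)
  moreover have "cv_estimator_exact mH X \<mu> l = (\<lambda>\<omega>. ?A \<omega> + l \<bullet> \<mu>)"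
    by (simp add: fun_eq_iff cv_estimator_exact_def h_def)
  ultimately show ?exact
    unfolding P.variance_eq_covariance by simp
qed

section \<open>Optimal coefficients and optimal variances\<close>

text \<open>A minimizer of \<open>cv_cost\<close> carries over directly. Here and below
  \<open>E\<close> enters only through its variances, so that sampled and known means are handled
  alike.\<close>

lemma opt_coeff_exists:
  fixes Q :: "'a \<Rightarrow> 'e::euclidean_space"
  assumes "prob_space M" "in_L2 M U" "in_L2 M Q" "a + b > 0"
    and "\<And>l. prob_space.variance P (E l) = cv_cost M a b U Q l"
  shows "\<exists>l. is_opt_coeff P E l"
proof -
  obtain l where "\<forall>l'. cv_cost M a b U Q l \<le> cv_cost M a b U Q l'"
    using prob_space.cv_cost_minimizer[OF assms(1-4)] ..
  then have "is_opt_coeff P E l"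
    unfolding is_opt_coeff_def is_arg_min_linorder assms(5) by simp
  then show ?thesis ..
qed

text \<open>Nonnegative weights bound the costs below by 0; without such a bound the real infimum
  need not be a lower bound.\<close>

lemma opt_variance_le:
  assumes "a \<ge> 0" "b \<ge> 0" "prob_space M"
    and "\<And>l. prob_space.variance P (E l) = cv_cost M a b U Q l"
  shows "opt_variance P E \<le> cv_cost M a b U Q l"
proof -
  have "bdd_below (range (cv_cost M a b U Q))"
    using assms by (intro bdd_belowI[of _ 0]) (auto simp: cv_cost_def prob_space.covariance_nonneg)
  then show ?thesis
    unfolding opt_variance_def assms(4) by (rule cINF_lower) simp
qed

lemma opt_variance_ge:
  fixes Q :: "'a \<Rightarrow> 'e::euclidean_space"
  assumes "prob_space M" "in_L2 M U" "in_L2 M Q" "a + b > 0"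
    and "\<And>l. prob_space.variance P (E l) = cv_cost M a b U Q l"
  shows "a * b / (a + b) * covariance M U U \<le> opt_variance P E"
  unfolding opt_variance_def assms(5)
  by (rule cINF_greatest, simp, rule prob_space.cv_cost_lower_bound[OF assms(1-4)])

text \<open>For one nonconstant control the completed square is a parabola with leading coefficient
  \<open>(a + b) * covariance M Q Q > 0\<close>, hence with a strict minimum at \<open>l0\<close>,
  the root of the scalar normal equation.\<close>

lemma single_control_opt_coeff:
  fixes Q :: "'a \<Rightarrow> real"
  assumes "prob_space M" "in_L2 M U" "in_L2 M Q" "a + b > 0" "covariance M Q Q > 0"
    and "\<And>l. prob_space.variance P (E l) = cv_cost M a b U Q l"
  shows "\<exists>!l. is_opt_coeff P E l"
    and "opt_coeff P E = a / (a + b) * (covariance M U Q / covariance M Q Q)"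
proof -
  interpret prob_space M by fact
  define l0 where "l0 = a / (a + b) * (covariance M U Q / covariance M Q Q)"
  have cov: "covariance M Z (\<lambda>\<omega>. v \<bullet> Q \<omega>) = v * covariance M Z Q" if "in_L2 M Z" for Z v
    using covariance_cmult_left[OF assms(3) that, of v]
    by (simp add: covariance_commute[of Z])
  have L2: "in_L2 M (\<lambda>\<omega>. v \<bullet> Q \<omega>)" for v
    using assms(3) by (rule in_L2_inner)
  have cov2: "covariance M (\<lambda>\<omega>. u \<bullet> Q \<omega>) (\<lambda>\<omega>. v \<bullet> Q \<omega>) = u * v * covariance M Q Q" for u v
    using cov[OF L2, of u v] cov[OF assms(3), of u] covariance_commute[of Q "\<lambda>\<omega>. u \<bullet> Q \<omega>"]
    by simp
  have "(a + b) * covariance M (\<lambda>\<omega>. l0 \<bullet> Q \<omega>) (\<lambda>\<omega>. v \<bullet> Q \<omega>) = a * covariance M U (\<lambda>\<omega>. v \<bullet> Q \<omega>)" for v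
    unfolding cov2 cov[OF assms(2)] l0_def using assms(4,5) by simp
  note square = cv_cost_eq[OF assms(2,3) this]
  have cost: "cv_cost M a b U Q l = cv_cost M a b U Q l0
      + (a + b) * covariance M Q Q * (l - l0)\<^sup>2" for l
    unfolding square[of l] cov2 by (simp add: power2_eq_square)
  have pos: "(a + b) * covariance M Q Q > 0"
    using assms(4,5) by simp
  have iff: "is_opt_coeff P E l \<longleftrightarrow> l = l0" for l
  proof
    assume "is_opt_coeff P E l"
    then have "(a + b) * covariance M Q Q * (l - l0)\<^sup>2 \<le> 0"
      unfolding is_opt_coeff_def is_arg_min_linorder assms(6)
      using cost[of l] by (metis add_le_same_cancel1)
    then have "(l - l0)\<^sup>2 \<le> 0"
      using mult_pos_pos[OF pos, of "(l - l0)\<^sup>2"] by linarith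
    then show "l = l0"
      by simp
  next
    assume "l = l0"
    moreover have "0 \<le> (a + b) * covariance M Q Q * (l' - l0)\<^sup>2" for l'
      using pos by simp
    ultimately show "is_opt_coeff P E l"
      unfolding is_opt_coeff_def is_arg_min_linorder assms(6) by (metis cost le_add_same_cancel1)
  qed
  show "\<exists>!l. is_opt_coeff P E l"
    unfolding iff by simp
  \<comment> \<open>\<open>arg_min\<close> is a Hilbert choice; uniqueness of the minimizer fixes
    its value.\<close>
  have "opt_coeff P E = (SOME l. is_opt_coeff P E l)"
    by (simp add: opt_coeff_def arg_min_def is_opt_coeff_def)
  then show "opt_coeff P E = a / (a + b) * (covariance M U Q / covariance M Q Q)"
    unfolding iff l0_def[symmetric] by simp
qed

section \<open>Passage to the limit\<close>

text \<open>With \<open>D = U - W\<close> everything expands into the variance of \<open>D\<close>,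
  its covariance with \<open>W\<close> and the variance of \<open>W\<close>; the first two tend to
  0. The instance \<open>t = 0\<close> gives convergence of the variances of
  \<open>U i\<close>.\<close>

lemma L2_tendsto_covariance:
  fixes U :: "'i \<Rightarrow> 'a \<Rightarrow> real"
  assumes "prob_space M" "\<forall>\<^sub>F i in F. in_L2 M (U i)" "in_L2 M W"
    and "((\<lambda>i. L2_norm M (\<lambda>\<omega>. U i \<omega> - W \<omega>)) \<longlongrightarrow> 0) F"
  shows "((\<lambda>i. covariance M (U i) W) \<longlongrightarrow> covariance M W W) F"
    and "((\<lambda>i. covariance M (\<lambda>\<omega>. U i \<omega> - t * W \<omega>) (\<lambda>\<omega>. U i \<omega> - t * W \<omega>))
      \<longlongrightarrow> (1 - t)\<^sup>2 * covariance M W W) F"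
proof -
  interpret prob_space M by fact
  let ?D = "\<lambda>i \<omega>. U i \<omega> - W \<omega>"
  have D: "\<forall>\<^sub>F i in F. in_L2 M (?D i)"
    using assms(2) by eventually_elim (use assms(3) in_L2_diff in blast)
  have var: "((\<lambda>i. covariance M (?D i) (?D i)) \<longlongrightarrow> 0) F"
  proof (rule tendsto_sandwich)
    show "\<forall>\<^sub>F i in F. 0 \<le> covariance M (?D i) (?D i)"
      by (simp add: covariance_nonneg)
    \<comment> \<open>The variance is the second moment minus the squared mean.\<close>
    show "\<forall>\<^sub>F i in F. covariance M (?D i) (?D i) \<le> (L2_norm M (?D i))\<^sup>2"
      using D
    proof eventually_elim
      case (elim i)
      show ?case
        unfolding covariance_eq[OF elim elim] by (simp add: L2_norm_def power2_eq_square)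
    qed
    show "((\<lambda>i. (L2_norm M (?D i))\<^sup>2) \<longlongrightarrow> 0) F"
      using tendsto_power[OF assms(4), of 2] by simp
  qed simp
  \<comment> \<open>The square is what Cauchy-Schwarz bounds by the vanishing variance of
    \<open>?D i\<close> times a constant.\<close>
  have "((\<lambda>i. (covariance M (?D i) W)\<^sup>2) \<longlongrightarrow> 0) F"
  proof (rule tendsto_sandwich[where f = "\<lambda>_. 0"])
    show "\<forall>\<^sub>F i in F. (covariance M (?D i) W)\<^sup>2 \<le> covariance M (?D i) (?D i) * covariance M W W"
      using D by eventually_elim (rule covariance_Cauchy_Schwarz[OF _ assms(3)])
    show "((\<lambda>i. covariance M (?D i) (?D i) * covariance M W W) \<longlongrightarrow> 0) F"
      using tendsto_mult_right[OF var] by simp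
  qed simp_all
  then have cov: "((\<lambda>i. covariance M (?D i) W) \<longlongrightarrow> 0) F"
    by simp
  have "((\<lambda>i. covariance M (?D i) W + covariance M W W) \<longlongrightarrow> 0 + covariance M W W) F"
    by (intro tendsto_intros cov)
  moreover have "\<forall>\<^sub>F i in F. covariance M (?D i) W + covariance M W W = covariance M (U i) W"
    using assms(2) by eventually_elim (simp add: covariance_diff_left assms(3))
  ultimately show "((\<lambda>i. covariance M (U i) W) \<longlongrightarrow> covariance M W W) F"
    using tendsto_cong by force
  have "((\<lambda>i. covariance M (?D i) (?D i) + 2 * (1 - t) * covariance M (?D i) W
      + (1 - t)\<^sup>2 * covariance M W W) \<longlongrightarrow> 0 + 2 * (1 - t) * 0 + (1 - t)\<^sup>2 * covariance M W W) F"
    by (intro tendsto_intros var cov)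
  moreover have "\<forall>\<^sub>F i in F. covariance M (?D i) (?D i) + 2 * (1 - t) * covariance M (?D i) W
      + (1 - t)\<^sup>2 * covariance M W W
    = covariance M (\<lambda>\<omega>. U i \<omega> - t * W \<omega>) (\<lambda>\<omega>. U i \<omega> - t * W \<omega>)"
    using D
  proof eventually_elim
    case (elim i)
    have "(\<lambda>\<omega>. U i \<omega> - t * W \<omega>) = (\<lambda>\<omega>. 1 * ?D i \<omega> + (1 - t) * W \<omega>)"
      by (simp add: algebra_simps)
    then show ?case
      by (simp only: variance_linear_comb[OF elim assms(3)]) simp
  qed
  ultimately show "((\<lambda>i. covariance M (\<lambda>\<omega>. U i \<omega> - t * W \<omega>) (\<lambda>\<omega>. U i \<omega> - t * W \<omega>))
      \<longlongrightarrow> (1 - t)\<^sup>2 * covariance M W W) F"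
    using tendsto_cong by force
qed

text \<open>A sandwich between the lower bound valid for all controls and the cost of one test
  coefficient. The vector \<open>e\<close> singles out \<open>W\<close> among the controls, so the
  upper bound involves only \<open>U i\<close> and \<open>W\<close>. Known means are the case
  \<open>b = 0\<close>.\<close>

lemma opt_variance_tendsto:
  fixes Q :: "'i \<Rightarrow> 'a \<Rightarrow> 'e::euclidean_space"
  assumes "prob_space M" "a > 0" "b \<ge> 0" "\<forall>\<^sub>F i in F. in_L2 M (U i)" "\<forall>\<^sub>F i in F. in_L2 M (Q i)"
    and "in_L2 M W" "((\<lambda>i. L2_norm M (\<lambda>\<omega>. U i \<omega> - W \<omega>)) \<longlongrightarrow> 0) F"
    and e: "\<And>i \<omega>. e \<bullet> Q i \<omega> = W \<omega>"
    and V: "\<forall>\<^sub>F i in F. \<forall>l. prob_space.variance (P i) (E i l) = cv_cost M a b (U i) (Q i) l"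
  shows "((\<lambda>i. opt_variance (P i) (E i)) \<longlongrightarrow> a * b / (a + b) * covariance M W W) F"
proof (rule tendsto_sandwich)
  interpret prob_space M by fact
  let ?t = "a / (a + b)"
  note lim = L2_tendsto_covariance[OF assms(1,4,6,7)]
  show "\<forall>\<^sub>F i in F. a * b / (a + b) * covariance M (U i) (U i) \<le> opt_variance (P i) (E i)"
    using assms(4,5) V
    by eventually_elim (use assms in \<open>intro opt_variance_ge; simp\<close>)
  show "\<forall>\<^sub>F i in F. opt_variance (P i) (E i) \<le> cv_cost M a b (U i) (Q i) (?t *\<^sub>R e)"
    using V by eventually_elim (use assms in \<open>intro opt_variance_le; simp\<close>)
  show "((\<lambda>i. a * b / (a + b) * covariance M (U i) (U i)) \<longlongrightarrow> a * b / (a + b) * covariance M W W) F"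
    using lim(2)[of 0] by (intro tendsto_mult_left) simp
  have "((\<lambda>i. a * covariance M (\<lambda>\<omega>. U i \<omega> - ?t * W \<omega>) (\<lambda>\<omega>. U i \<omega> - ?t * W \<omega>)
      + b * (?t\<^sup>2 * covariance M W W))
      \<longlongrightarrow> a * ((1 - ?t)\<^sup>2 * covariance M W W) + b * (?t\<^sup>2 * covariance M W W)) F"
    by (intro tendsto_intros lim)
  \<comment> \<open>The two bounds meet because \<open>?t\<close> minimizes
    \<open>a (1 - t)^2 + b t^2\<close>, with minimum \<open>a b / (a + b)\<close>.\<close>
  moreover have "a * ((1 - ?t)\<^sup>2 * covariance M W W) + b * (?t\<^sup>2 * covariance M W W)
      = a * b / (a + b) * covariance M W W"
  proof -
    define s t where "s = a + b" and "t = a / s"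
    have s: "s > 0" and a: "a = t * s" and b: "b = s - t * s"
      using assms(2,3) by (auto simp: s_def t_def)
    have "?t = t" and "a * b / (a + b) = t * (s - t * s)"
      using s by (simp_all add: a b)
    then show ?thesis
      by (simp only:) (simp add: a b power2_eq_square algebra_simps)
  qed
  moreover have "cv_cost M a b (U i) (Q i) (?t *\<^sub>R e)
      = a * covariance M (\<lambda>\<omega>. U i \<omega> - ?t * W \<omega>) (\<lambda>\<omega>. U i \<omega> - ?t * W \<omega>)
      + b * (?t\<^sup>2 * covariance M W W)" for i
    using variance_linear_comb[OF assms(6,6), of ?t 0]
    unfolding cv_cost_def inner_scaleR_left e by simp
  ultimately show "((\<lambda>i. cv_cost M a b (U i) (Q i) (?t *\<^sub>R e)) \<longlongrightarrow> a * b / (a + b) * covariance M W W) F"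
    by simp
qed

section \<open>The estimators with two controls and with one\<close>

lemma in_L2_vector_2:
  assumes "in_L2 M X" "in_L2 M Y"
  shows "in_L2 M (\<lambda>\<omega>. vector [X \<omega>, Y \<omega>] :: real ^ 2)"
  unfolding in_L2_def
proof
  show "(\<lambda>\<omega>. vector [X \<omega>, Y \<omega>] :: real ^ 2) \<in> borel_measurable M"
  proof (subst borel_measurable_euclidean_space, rule ballI)
    fix i :: "real ^ 2" assume "i \<in> Basis"
    then obtain j where "i = axis j 1"
      by (auto simp: Basis_vec_def)
    then show "(\<lambda>\<omega>. (vector [X \<omega>, Y \<omega>] :: real ^ 2) \<bullet> i) \<in> borel_measurable M"
      using assms exhaust_2[of j] by (auto simp: in_L2_def inner_axis)
  qed
  have "(norm (vector [x, y] :: real ^ 2))\<^sup>2 = x\<^sup>2 + y\<^sup>2" for x y :: real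
    unfolding power2_norm_eq_inner by (simp add: inner_vec_def sum_2 power2_eq_square)
  then show "integrable M (\<lambda>\<omega>. (norm (vector [X \<omega>, Y \<omega>] :: real ^ 2))\<^sup>2)"
    using assms by (simp add: in_L2_def)
qed

theorem proposition3p6:
  fixes M :: "'a measure"
    and mH mL :: nat
    and QH QN :: "real \<Rightarrow> 'a \<Rightarrow> real" and QE :: "'a \<Rightarrow> real"
    and P :: "real \<Rightarrow> 'b measure"
    and X :: "real \<Rightarrow> nat \<Rightarrow> 'b \<Rightarrow> real \<times> (real ^ 2)"
    and Y :: "real \<Rightarrow> nat \<Rightarrow> 'b \<Rightarrow> real ^ 2"
    and P' :: "real \<Rightarrow> 'c measure"
    and X' :: "real \<Rightarrow> nat \<Rightarrow> 'c \<Rightarrow> real \<times> real"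
    and Y' :: "real \<Rightarrow> nat \<Rightarrow> 'c \<Rightarrow> real"
  assumes "prob_space M" and "mH \<ge> 1" and "mL \<ge> 1"
    and "\<And>\<epsilon>. \<epsilon> > 0 \<Longrightarrow> in_L2 M (QH \<epsilon>)"
    and "\<And>\<epsilon>. \<epsilon> > 0 \<Longrightarrow> in_L2 M (QN \<epsilon>)"
    and "in_L2 M QE"
    and "((\<lambda>\<epsilon>. L2_norm M (\<lambda>\<omega>. QH \<epsilon> \<omega> - QE \<omega>)) \<longlongrightarrow> 0) (at_right 0)"
    and "prob_space.variance M QE > 0"
    and "\<And>\<epsilon>. \<epsilon> > 0 \<Longrightarrow>
      cv_samples M (QH \<epsilon>) (\<lambda>\<omega>. vector [QN \<epsilon> \<omega>, QE \<omega>]) mH mL (P \<epsilon>) (X \<epsilon>) (Y \<epsilon>)"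
    and "\<And>\<epsilon>. \<epsilon> > 0 \<Longrightarrow>
      cv_samples M (QH \<epsilon>) QE mH mL (P' \<epsilon>) (X' \<epsilon>) (Y' \<epsilon>)"
  shows
    "(\<forall>\<epsilon>>0. \<exists>l. is_opt_coeff (P \<epsilon>) (cv_estimator mH mL (X \<epsilon>) (Y \<epsilon>)) l) \<and>
     (\<forall>\<epsilon>>0. \<exists>!l. is_opt_coeff (P' \<epsilon>) (cv_estimator mH mL (X' \<epsilon>) (Y' \<epsilon>)) l) \<and>
     (((\<lambda>\<epsilon>. opt_variance (P \<epsilon>) (cv_estimator mH mL (X \<epsilon>) (Y \<epsilon>)))
        \<longlongrightarrow> prob_space.variance M QE / (real mH + real mL)) (at_right 0)) \<and>
     (((\<lambda>\<epsilon>. opt_variance (P' \<epsilon>) (cv_estimator mH mL (X' \<epsilon>) (Y' \<epsilon>)))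
        \<longlongrightarrow> prob_space.variance M QE / (real mH + real mL)) (at_right 0)) \<and>
     (((\<lambda>\<epsilon>. opt_variance (P' \<epsilon>) (cv_estimator mH mL (X' \<epsilon>) (Y' \<epsilon>))
          - opt_variance (P \<epsilon>) (cv_estimator mH mL (X \<epsilon>) (Y \<epsilon>))) \<longlongrightarrow> 0) (at_right 0)) \<and>
     (\<forall>\<epsilon>>0. opt_coeff (P' \<epsilon>) (cv_estimator mH mL (X' \<epsilon>) (Y' \<epsilon>))
        = real mL / (real mH + real mL) * (covariance M (QH \<epsilon>) QE / prob_space.variance M QE)) \<and>
     (((\<lambda>\<epsilon>. opt_coeff (P' \<epsilon>) (cv_estimator mH mL (X' \<epsilon>) (Y' \<epsilon>)))
        \<longlongrightarrow> real mL / (real mH + real mL)) (at_right 0)) \<and>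
     (\<forall>\<epsilon>>0. \<exists>l. is_opt_coeff (P \<epsilon>)
        (cv_estimator_exact mH (X \<epsilon>) (\<integral>\<omega>. vector [QN \<epsilon> \<omega>, QE \<omega>] \<partial>M)) l) \<and>
     (\<forall>\<epsilon>>0. \<exists>!l. is_opt_coeff (P' \<epsilon>)
        (cv_estimator_exact mH (X' \<epsilon>) (prob_space.expectation M QE)) l) \<and>
     (((\<lambda>\<epsilon>. opt_variance (P \<epsilon>)
          (cv_estimator_exact mH (X \<epsilon>) (\<integral>\<omega>. vector [QN \<epsilon> \<omega>, QE \<omega>] \<partial>M)))
        \<longlongrightarrow> 0) (at_right 0)) \<and>
     (((\<lambda>\<epsilon>. opt_variance (P' \<epsilon>)
          (cv_estimator_exact mH (X' \<epsilon>) (prob_space.expectation M QE)))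
        \<longlongrightarrow> 0) (at_right 0)) \<and>
     (((\<lambda>\<epsilon>. opt_coeff (P' \<epsilon>)
          (cv_estimator_exact mH (X' \<epsilon>) (prob_space.expectation M QE)))
        \<longlongrightarrow> 1) (at_right 0))"
proof -
  note pos = assms(2,3)
  interpret prob_space M by fact
  let ?Q = "\<lambda>\<epsilon> \<omega>. vector [QN \<epsilon> \<omega>, QE \<omega>] :: real ^ 2"
  let ?a = "1 / real mH" and ?b = "1 / real mL"
  have QL2: "in_L2 M (?Q \<epsilon>)" if "\<epsilon> > 0" for \<epsilon>
    using assms(5)[OF that] assms(6) by (rule in_L2_vector_2)
  have ab: "?a > 0" "?b \<ge> 0" "?a + ?b > 0" "?a + 0 > 0"
    using pos by (simp_all add: add_pos_nonneg)
  \<comment> \<open>The abstract constants \<open>a b / (a + b)\<close> and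
    \<open>a / (a + b)\<close> become those of the sampled case.\<close>
  have avg: "?a * ?b / (?a + ?b) = 1 / (real mH + real mL)"
    and quot: "?a / (?a + ?b) = real mL / (real mH + real mL)"
    using pos by (simp_all add: divide_simps)
  have V: "prob_space.variance (P \<epsilon>) (cv_estimator mH mL (X \<epsilon>) (Y \<epsilon>) l)
        = cv_cost M ?a ?b (QH \<epsilon>) (?Q \<epsilon>) l"
    "prob_space.variance (P \<epsilon>) (cv_estimator_exact mH (X \<epsilon>) \<mu> l)
        = cv_cost M ?a 0 (QH \<epsilon>) (?Q \<epsilon>) l" if "\<epsilon> > 0" for \<epsilon> \<mu> l
    using cv_estimator_variance[OF assms(1) pos assms(4) QL2 assms(9)] that by blast+
  have V': "prob_space.variance (P' \<epsilon>) (cv_estimator mH mL (X' \<epsilon>) (Y' \<epsilon>) l)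
        = cv_cost M ?a ?b (QH \<epsilon>) QE l"
    "prob_space.variance (P' \<epsilon>) (cv_estimator_exact mH (X' \<epsilon>) \<mu>' l)
        = cv_cost M ?a 0 (QH \<epsilon>) QE l" if "\<epsilon> > 0" for \<epsilon> \<mu>' l
    using cv_estimator_variance[OF assms(1) pos assms(4) assms(6) assms(10)] that by blast+
  \<comment> \<open>The hypotheses concern positive \<open>\<epsilon>\<close>, which is all that
    \<open>at_right 0\<close> sees.\<close>
  have ev: "\<forall>\<^sub>F \<epsilon> in at_right 0. p \<epsilon>" if "\<And>\<epsilon>. \<epsilon> > 0 \<Longrightarrow> p \<epsilon>" for p :: "real \<Rightarrow> bool"
    using that by (auto simp: eventually_at_filter)
  have evU: "\<forall>\<^sub>F \<epsilon> in at_right 0. in_L2 M (QH \<epsilon>)"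
    by (intro ev assms(4))
  have evQ: "\<forall>\<^sub>F \<epsilon> in at_right (0::real). in_L2 M (?Q \<epsilon>)"
    by (intro ev QL2)
  have evE: "\<forall>\<^sub>F \<epsilon> in at_right (0::real). in_L2 M QE"
    using assms(6) by simp
  \<comment> \<open>\<open>QE\<close> is the second of the two controls, so the second unit vector
    selects it; for the single control the coefficient 1 does.\<close>
  have e: "axis 2 1 \<bullet> ?Q \<epsilon> \<omega> = QE \<omega>" for \<epsilon> \<omega>
    by (simp add: inner_axis')
  have e': "1 \<bullet> QE \<omega> = QE \<omega>" for \<omega>
    by simp
  have var: "variance QE = covariance M QE QE"
    by (rule variance_eq_covariance)
  have varpos: "covariance M QE QE > 0"
    using assms(8) unfolding var .
  note lim = opt_variance_tendsto[where W = QE, OF assms(1) ab(1) _ evU _ assms(6,7)]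
  have limit: "variance QE / (real mH + real mL) = ?a * ?b / (?a + ?b) * covariance M QE QE"
    unfolding var avg by simp
  have V1: "((\<lambda>\<epsilon>. opt_variance (P \<epsilon>) (cv_estimator mH mL (X \<epsilon>) (Y \<epsilon>)))
      \<longlongrightarrow> variance QE / (real mH + real mL)) (at_right 0)"
    unfolding limit by (rule lim[OF ab(2) evQ e]) (intro ev allI V(1))
  have V2: "((\<lambda>\<epsilon>. opt_variance (P' \<epsilon>) (cv_estimator mH mL (X' \<epsilon>) (Y' \<epsilon>)))
      \<longlongrightarrow> variance QE / (real mH + real mL)) (at_right 0)"
    unfolding limit by (rule lim[OF ab(2) evE e']) (intro ev allI V'(1))
  \<comment> \<open>For \<open>b = 0\<close> the limit \<open>a b / (a + b)\<close> times the
    variance is 0; the rule is simplified first so that its conclusion has this form.\<close>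
  have V3: "((\<lambda>\<epsilon>. opt_variance (P \<epsilon>)
      (cv_estimator_exact mH (X \<epsilon>) (\<integral>\<omega>. vector [QN \<epsilon> \<omega>, QE \<omega>] \<partial>M))) \<longlongrightarrow> 0) (at_right 0)"
    by (rule lim[where b = 0, simplified mult_zero_right div_0 mult_zero_left, OF order_refl evQ e])
      (intro ev allI V(2))
  have V4: "((\<lambda>\<epsilon>. opt_variance (P' \<epsilon>)
      (cv_estimator_exact mH (X' \<epsilon>) (expectation QE))) \<longlongrightarrow> 0) (at_right 0)"
    by (rule lim[where b = 0, simplified mult_zero_right div_0 mult_zero_left, OF order_refl evE e'])
      (intro ev allI V'(2))
  have C1: "opt_coeff (P' \<epsilon>) (cv_estimator mH mL (X' \<epsilon>) (Y' \<epsilon>))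
      = real mL / (real mH + real mL) * (covariance M (QH \<epsilon>) QE / variance QE)" if "\<epsilon> > 0" for \<epsilon>
    unfolding var quot[symmetric]
    by (rule single_control_opt_coeff(2)[OF assms(1) assms(4)[OF that] assms(6) ab(3) varpos
          V'(1)[OF that]])
  \<comment> \<open>For \<open>b = 0\<close> the prefactor \<open>a / (a + b)\<close> is 1.\<close>
  have C2: "opt_coeff (P' \<epsilon>) (cv_estimator_exact mH (X' \<epsilon>) (expectation QE))
      = covariance M (QH \<epsilon>) QE / variance QE" if "\<epsilon> > 0" for \<epsilon>
    unfolding var
    using single_control_opt_coeff(2)[OF assms(1) assms(4)[OF that] assms(6) ab(4) varpos
          V'(2)[OF that]] pos by simp
  have "((\<lambda>\<epsilon>. covariance M (QH \<epsilon>) QE / variance QE) \<longlongrightarrow> variance QE / variance QE) (at_right 0)"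
    unfolding var
    by (intro tendsto_divide tendsto_const L2_tendsto_covariance(1)[OF assms(1) evU assms(6,7)])
      (use varpos in simp_all)
  then have ratio: "((\<lambda>\<epsilon>. covariance M (QH \<epsilon>) QE / variance QE) \<longlongrightarrow> 1) (at_right 0)"
    using assms(8) by simp
  have C1_lim: "((\<lambda>\<epsilon>. opt_coeff (P' \<epsilon>) (cv_estimator mH mL (X' \<epsilon>) (Y' \<epsilon>)))
      \<longlongrightarrow> real mL / (real mH + real mL)) (at_right 0)"
    using tendsto_mult_left[OF ratio, of "real mL / (real mH + real mL)"]
    by (subst tendsto_cong[OF ev[OF C1]]) simp_all
  have C2_lim: "((\<lambda>\<epsilon>. opt_coeff (P' \<epsilon>) (cv_estimator_exact mH (X' \<epsilon>) (expectation QE)))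
      \<longlongrightarrow> 1) (at_right 0)"
    using ratio by (subst tendsto_cong[OF ev[OF C2]]) simp_all
  show ?thesis
  proof (intro conjI allI impI V1 V2 V3 V4 C1 C1_lim C2_lim)
    fix \<epsilon> :: real assume \<epsilon>: "\<epsilon> > 0"
    note L2 = assms(1) assms(4)[OF \<epsilon>]
    show "\<exists>l. is_opt_coeff (P \<epsilon>) (cv_estimator mH mL (X \<epsilon>) (Y \<epsilon>)) l"
      by (rule opt_coeff_exists[OF L2 QL2[OF \<epsilon>] ab(3) V(1)[OF \<epsilon>]])
    show "\<exists>!l. is_opt_coeff (P' \<epsilon>) (cv_estimator mH mL (X' \<epsilon>) (Y' \<epsilon>)) l"
      by (rule single_control_opt_coeff(1)[OF L2 assms(6) ab(3) varpos V'(1)[OF \<epsilon>]])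
    show "\<exists>l. is_opt_coeff (P \<epsilon>)
        (cv_estimator_exact mH (X \<epsilon>) (\<integral>\<omega>. vector [QN \<epsilon> \<omega>, QE \<omega>] \<partial>M)) l"
      by (rule opt_coeff_exists[OF L2 QL2[OF \<epsilon>] ab(4) V(2)[OF \<epsilon>]])
    show "\<exists>!l. is_opt_coeff (P' \<epsilon>) (cv_estimator_exact mH (X' \<epsilon>) (expectation QE)) l"
      by (rule single_control_opt_coeff(1)[OF L2 assms(6) ab(4) varpos V'(2)[OF \<epsilon>]])
  next
    show "((\<lambda>\<epsilon>. opt_variance (P' \<epsilon>) (cv_estimator mH mL (X' \<epsilon>) (Y' \<epsilon>))
        - opt_variance (P \<epsilon>) (cv_estimator mH mL (X \<epsilon>) (Y \<epsilon>))) \<longlongrightarrow> 0) (at_right 0)"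
      using tendsto_diff[OF V2 V1] by simp
  qed
qed

end
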